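(* Let $A,a$ be positive integers. As formal power series in $q$, $$\sum_{n\geq0}p_{A,a}(n)q^n=\frac{1}{(q;q)_\infty}\sum_{n\geq0}(-1)^nq^{\frac{An(n-1)}{2}+an}.$$
   Context: $(q;q)_\infty=\prod_{k\ge1}(1-q^k)$. A partition of $n$ is a finite multiset of positive integers summing to $n$. For positive integers $A,a$ and a partition $\pi$, $\mathrm{mex}_{A,a}(\pi)$ is the smallest element of $\{a,a+A,a+2A,\dots\}$ that is not a part of $\pi$. $p_{A,a}(n)$ is the number of partitions $\pi$ of $n$ with $\mathrm{mex}_{A,a}(\pi)\equiv a \pmod{2A}$ (so $p_{A,a}(0)=1$). *)

theory Defs
  imports
    "HOL-Analysis.Analysis"
    "HOL-Computational_Algebra.Formal_Power_Series"
    "HOL-Library.Multiset"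
    "HOL-Number_Theory.Cong"
begin

definition partitions_of :: "nat \<Rightarrow> nat multiset set" where
  "partitions_of n = {\<pi>. (\<forall>i \<in># \<pi>. i > 0) \<and> sum_mset \<pi> = n}"

lemma finite_partitions_of: "finite (partitions_of n)"
proof (rule finite_subset)
  show "partitions_of n \<subseteq> mset ` {xs. set xs \<subseteq> {..n} \<and> length xs \<le> n}"
  proof
    fix \<pi> assume "\<pi> \<in> partitions_of n"
    hence pos: "\<forall>i \<in># \<pi>. i > 0" and sum: "sum_mset \<pi> = n"
      by (auto simp: partitions_of_def)
    obtain xs where xs: "\<pi> = mset xs"
      by (metis ex_mset)
    have "length xs \<le> sum_list xs" if "\<forall>i \<in> set xs. i > 0" for xs :: "nat list"
      using that by (induction xs) auto
    moreover have "sum_list xs = n"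
      using sum unfolding xs by (simp add: sum_mset_sum_list)
    moreover have "\<forall>i \<in> set xs. i > 0"
      using pos unfolding xs by simp
    ultimately have "length xs \<le> n" "set xs \<subseteq> {..n}"
      using member_le_sum_list by blast+
    thus "\<pi> \<in> mset ` {xs. set xs \<subseteq> {..n} \<and> length xs \<le> n}"
      unfolding xs by blast
  qed
  show "finite (mset ` {xs. set xs \<subseteq> {..n} \<and> length xs \<le> n})"
    by (intro finite_imageI finite_lists_length_le) auto
qed

definition mex :: "nat \<Rightarrow> nat \<Rightarrow> nat multiset \<Rightarrow> nat" where
  "mex A a \<pi> = (LEAST m. (\<exists>k. m = a + k * A) \<and> m \<notin># \<pi>)"

definition p_mex :: "nat \<Rightarrow> nat \<Rightarrow> nat \<Rightarrow> nat" where
  "p_mex A a n = card {\<pi> \<in> partitions_of n. [mex A a \<pi> = a] (mod (2 * A))}"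

text \<open>
  The product \<open>(q; q)\<^sub>\<infinity>\<close>, as a limit in the coefficientwise topology of formal power series.
  The coefficients are rational rather than integral because the library's division of formal
  power series requires division on the coefficients.
\<close>
definition qq_inf :: "rat fps" where
  "qq_inf = (\<Prod>k. 1 - fps_X ^ Suc k)"

end

theory Submission
  imports Defs
begin

text \<open>
  Fix the modulus \<open>A\<close> and write \<open>P\<close> for the generating function of all partitions. Adding parts is
  injective, so partitions that contain \<open>a, a + A, \<dots>, a + (n - 1) A\<close> are counted by \<open>q\<close> to the sum
  of these numbers times \<open>P\<close>. A partition whose mex is \<open>a + k A\<close> contains these parts exactly for
  \<open>n \<le> k\<close>, so it contributes \<open>\<Sum>n\<le>k. (-1)\<^sup>n\<close> to the alternating sum over \<open>n\<close>, which is 1 or 0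
  according to the parity of \<open>k\<close>. The same injectivity for a single part \<open>k\<close> shows that multiplying
  by \<open>1 - q\<^sup>k\<close> discards the partitions containing \<open>k\<close>; hence \<open>P \<cdot> (q; q)\<^sub>\<infinity> = 1\<close>.
\<close>

text \<open>Convergence means that each coefficient is eventually constant. Coefficient n of a
  product involves only the finitely many coefficients up to n, so they are all constant from a
  common point on.\<close>

lemma tendsto_mult_right_fps:
  fixes f :: "'b \<Rightarrow> 'a :: ring_1 fps"
  assumes "(f \<longlongrightarrow> l) F"
  shows "((\<lambda>x. f x * c) \<longlongrightarrow> l * c) F"
proof (rule tendsto_fpsI)
  fix n
  have "eventually (\<lambda>x. \<forall>i\<in>{..n}. fps_nth (f x) i = fps_nth l i) F"
    using assms by (intro eventually_ball_finite) (auto simp: tendsto_fps_iff)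
  then show "eventually (\<lambda>x. fps_nth (f x * c) n = fps_nth (l * c) n) F"
    by eventually_elim (auto simp: fps_mult_nth intro!: sum.cong)
qed

section \<open>Partitions with prescribed and forbidden parts\<close>

lemma card_partitions_of_containing:
  assumes "finite F" "0 \<notin> F" "F \<inter> S = {}"
  shows "card {\<pi> \<in> partitions_of n. F \<subseteq> set_mset \<pi> \<and> set_mset \<pi> \<inter> S = {}} =
    (if \<Sum>F \<le> n then card {\<pi> \<in> partitions_of (n - \<Sum>F). set_mset \<pi> \<inter> S = {}} else 0)"
    (is "card ?L = _")
proof -
  have sub: "mset_set F \<subseteq># \<pi> \<longleftrightarrow> F \<subseteq> set_mset \<pi>" for \<pi>
  proof
    assume "mset_set F \<subseteq># \<pi>"
    then show "F \<subseteq> set_mset \<pi>"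
      using assms(1) set_mset_mono by fastforce
  next
    assume "F \<subseteq> set_mset \<pi>"
    then show "mset_set F \<subseteq># \<pi>"
      by (metis mset_set_set_mset_msubset subset_imp_msubset_mset_set finite_set_mset
          subset_mset.order_trans)
  qed
  have sum: "\<Sum>\<^sub># (mset_set F) = \<Sum>F"
    by (simp add: sum_unfold_sum_mset)
  show ?thesis
  proof (cases "\<Sum>F \<le> n")
    case True
    let ?R = "{\<pi> \<in> partitions_of (n - \<Sum>F). set_mset \<pi> \<inter> S = {}}"
    \<comment> \<open>One copy of each element of \<open>F\<close> is added or removed. Further
      copies may remain, so \<open>F\<close> puts no condition on the smaller partition.\<close>
    have "bij_betw (\<lambda>\<pi>. \<pi> + mset_set F) ?R ?L"
    proof (rule bij_betw_byWitness[where f' = "\<lambda>\<pi>. \<pi> - mset_set F"])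
      show "\<forall>\<pi>\<in>?L. \<pi> - mset_set F + mset_set F = \<pi>"
        by (simp add: sub)
      show "(\<lambda>\<pi>. \<pi> + mset_set F) ` ?R \<subseteq> ?L"
        using assms True by (auto simp: partitions_of_def sum intro: gr0I)
      show "(\<lambda>\<pi>. \<pi> - mset_set F) ` ?L \<subseteq> ?R"
      proof clarify
        fix \<pi> assume \<pi>: "\<pi> \<in> partitions_of n" "F \<subseteq> set_mset \<pi>" "set_mset \<pi> \<inter> S = {}"
        have "\<Sum>\<^sub># (\<pi> - mset_set F) = n - \<Sum>F"
          using \<pi> by (simp add: sum_mset_diff sub sum partitions_of_def)
        with \<pi> show "\<pi> - mset_set F \<in> partitions_of (n - \<Sum>F) \<and>
            set_mset (\<pi> - mset_set F) \<inter> S = {}"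
          by (auto simp: partitions_of_def dest: in_diffD)
      qed
    qed auto
    then show ?thesis
      using True by (simp add: bij_betw_same_card)
  next
    case False
    have "\<Sum>F \<le> n" if "\<pi> \<in> ?L" for \<pi>
    proof -
      have "\<Sum>\<^sub># (mset_set F) \<le> \<Sum>\<^sub># \<pi>"
        using that by (metis (no_types, lifting) mem_Collect_eq sub sum_mset.union le_add1
            subset_mset.add_diff_inverse)
      with that show ?thesis by (simp add: sum partitions_of_def)
    qed
    with False have "?L = {}" by blast
    then show ?thesis using False by (simp only: card.empty if_False)
  qed
qed

text \<open>One family serves both uses: \<open>S = {}\<close> gives all partitions, and letting
  \<open>S\<close> grow follows the partial products of \<open>qq_inf\<close>.\<close>

definition partitions_avoiding_gf :: "nat set \<Rightarrow> rat fps" where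
  "partitions_avoiding_gf S =
    Abs_fps (\<lambda>n. of_nat (card {\<pi> \<in> partitions_of n. set_mset \<pi> \<inter> S = {}}))"

lemma fps_X_power_mult_partitions_avoiding_gf:
  assumes "finite F" "0 \<notin> F" "F \<inter> S = {}"
  shows "fps_X ^ \<Sum>F * partitions_avoiding_gf S = Abs_fps (\<lambda>n. of_nat
    (card {\<pi> \<in> partitions_of n. F \<subseteq> set_mset \<pi> \<and> set_mset \<pi> \<inter> S = {}}))"
  by (rule fps_ext)
    (simp add: partitions_avoiding_gf_def fps_X_power_mult_nth card_partitions_of_containing[OF assms])

section \<open>Euler's product for the partition generating function\<close>

lemma partitions_avoiding_gf_insert:
  assumes "k > 0" "k \<notin> S"
  shows "(1 - fps_X ^ k) * partitions_avoiding_gf S = partitions_avoiding_gf (insert k S)"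
proof -
  have split: "card {\<pi> \<in> partitions_of n. set_mset \<pi> \<inter> S = {}} =
      card {\<pi> \<in> partitions_of n. set_mset \<pi> \<inter> insert k S = {}} +
      card {\<pi> \<in> partitions_of n. {k} \<subseteq> set_mset \<pi> \<and> set_mset \<pi> \<inter> S = {}}" for n
    by (subst card_Un_disjoint[symmetric]) (auto simp: finite_partitions_of intro!: arg_cong[of _ _ card])
  have "fps_X ^ \<Sum>{k} * partitions_avoiding_gf S =
      partitions_avoiding_gf S - partitions_avoiding_gf (insert k S)"
    unfolding fps_X_power_mult_partitions_avoiding_gf[of "{k}" S, simplified, OF assms(1)]
    by (subst fps_X_power_mult_partitions_avoiding_gf)
      (use assms in \<open>auto simp: fps_eq_iff partitions_avoiding_gf_def split\<close>)
  then show ?thesis by (simp add: algebra_simps)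
qed

lemma prod_mult_partitions_gf:
  "(\<Prod>i\<le>n. 1 - fps_X ^ Suc i) * partitions_avoiding_gf {} = partitions_avoiding_gf {0<..Suc n}"
proof (induction n)
  case 0
  have "{0<..Suc 0} = {Suc 0}" by auto
  then show ?case using partitions_avoiding_gf_insert[of 1 "{}"] by simp
next
  case (Suc n)
  have "{0<..Suc (Suc n)} = insert (Suc (Suc n)) {0<..Suc n}" by auto
  then have "(1 - fps_X ^ Suc (Suc n)) * partitions_avoiding_gf {0<..Suc n} =
      partitions_avoiding_gf {0<..Suc (Suc n)}"
    using partitions_avoiding_gf_insert[of "Suc (Suc n)" "{0<..Suc n}"] by simp
  then show ?case
    unfolding Suc.IH[symmetric] prod.atMost_Suc by (simp only: mult.assoc mult.left_commute)
qed

lemma partitions_of_0: "partitions_of 0 = {{#}}"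
proof -
  have "\<pi> = {#}" if "\<forall>i\<in>#\<pi>. 0 < i" "\<Sum>\<^sub># \<pi> = (0 :: nat)" for \<pi>
    using that by (cases \<pi>) auto
  then show ?thesis by (auto simp: partitions_of_def)
qed

lemma partitions_avoiding_gf_nth_0: "fps_nth (partitions_avoiding_gf S) 0 = 1"
proof -
  have "{\<pi> \<in> partitions_of 0. set_mset \<pi> \<inter> S = {}} = {{#}}"
    by (auto simp: partitions_of_0)
  then show ?thesis by (simp add: partitions_avoiding_gf_def)
qed

text \<open>The parts of a partition of m are at most m, so from n = m on only the empty partition
  can contribute to coefficient m.\<close>

lemma partitions_avoiding_gf_tendsto_1:
  "(\<lambda>n. partitions_avoiding_gf {0<..Suc n}) \<longlonglongrightarrow> 1"
proof (rule tendsto_fpsI)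
  fix m
  show "eventually (\<lambda>n. fps_nth (partitions_avoiding_gf {0<..Suc n}) m = fps_nth 1 m) sequentially"
    using eventually_ge_at_top[of m]
  proof eventually_elim
    case (elim n)
    show ?case
    proof (cases "m = 0")
      case True
      then show ?thesis by (simp add: partitions_avoiding_gf_nth_0)
    next
      case False
      have "set_mset \<pi> \<inter> {0<..Suc n} \<noteq> {}" if \<pi>: "\<pi> \<in> partitions_of m" for \<pi>
      proof -
        obtain i where i: "i \<in># \<pi>"
          using \<pi> False by (cases \<pi>) (auto simp: partitions_of_def)
        then have "i \<le> \<Sum>\<^sub># \<pi>"
          by (metis sum_mset.remove le_add1)
        with i \<pi> elim show ?thesis by (auto simp: partitions_of_def)
      qed
      then have none: "{\<pi> \<in> partitions_of m. set_mset \<pi> \<inter> {0<..Suc n} = {}} = {}" by blast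
      show ?thesis
        unfolding partitions_avoiding_gf_def fps_nth_Abs_fps none using False by simp
    qed
  qed
qed

theorem partitions_gf_eq: "partitions_avoiding_gf {} = 1 / qq_inf"
proof -
  let ?P = "partitions_avoiding_gf {}"
  have inv: "?P * inverse ?P = 1"
    by (rule inverse_mult_eq_1') (simp add: partitions_avoiding_gf_nth_0)
  \<comment> \<open>Multiplying by \<open>inverse ?P\<close> isolates the finite products, whose
    limit defines \<open>qq_inf\<close>.\<close>
  have "(\<Prod>i\<le>n. 1 - fps_X ^ Suc i) = partitions_avoiding_gf {0<..Suc n} * inverse ?P" for n
    unfolding prod_mult_partitions_gf[symmetric] by (simp add: mult.assoc inv)
  moreover have "(\<lambda>n. partitions_avoiding_gf {0<..Suc n} * inverse ?P) \<longlonglongrightarrow> 1 * inverse ?P"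
    by (intro tendsto_mult_right_fps partitions_avoiding_gf_tendsto_1)
  \<comment> \<open>\<open>raw_has_prod\<close> demands a nonzero limit.\<close>
  moreover have "inverse ?P \<noteq> 0"
  proof
    assume "inverse ?P = 0"
    with inv show False by (simp only: mult_zero_right zero_neq_one)
  qed
  ultimately have "(\<lambda>k. 1 - fps_X ^ Suc k) has_prod inverse ?P"
    by (simp add: has_prod_def raw_has_prod_def)
  then have "qq_inf = inverse ?P"
    unfolding qq_inf_def by (rule has_prod_unique[symmetric])
  moreover have "inverse (inverse ?P) = ?P"
    by (rule fps_inverse_idempotent) (simp add: partitions_avoiding_gf_nth_0)
  \<comment> \<open>Division by a series amounts to multiplication by its inverse when the constant
    coefficient is nonzero; here it is 1.\<close>
  moreover have "1 / inverse ?P = 1 * inverse (inverse ?P)"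
    by (rule fps_divide_unit) (simp add: partitions_avoiding_gf_nth_0)
  ultimately show ?thesis by simp
qed

section \<open>The mex condition as an alternating sum\<close>

lemma sum_arith_progression:
  fixes A a :: nat
  shows "(\<Sum>i<n. a + i * A) = A * n * (n - 1) div 2 + a * n"
proof (induction n)
  case (Suc n)
  \<comment> \<open>Evenness makes \<open>div 2\<close> exact, so that it splits over the sum in the
    next fact.\<close>
  have "even (A * n * (n - 1))"
    by (cases n) auto
  moreover have "A * Suc n * (Suc n - 1) = A * n * (n - 1) + 2 * (n * A)"
    by (cases n) (simp_all add: algebra_simps)
  ultimately show ?case using Suc by simp
qed simp

lemma mex_cong_iff:
  assumes "A > 0" "a > 0" "\<pi> \<in> partitions_of n" "n < N"
  shows "(of_bool [mex A a \<pi> = a] (mod (2 * A)) :: 'a :: comm_ring_1) =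
    (\<Sum>k<N. (-1) ^ k * of_bool ((\<lambda>i. a + i * A) ` {..<k} \<subseteq> set_mset \<pi>))"
proof -
  let ?f = "\<lambda>i. a + i * A"
  \<comment> \<open>Since a + n A exceeds n, it cannot be a part. This bounds the index of the mex
    by n, so any N > n captures all nonzero terms of the sum.\<close>
  have large: "?f n \<notin># \<pi>"
  proof
    assume "?f n \<in># \<pi>"
    then have "?f n \<le> \<Sum>\<^sub># \<pi>" by (metis sum_mset.remove le_add1)
    moreover have "n \<le> n * A" using assms by simp
    ultimately have "?f n \<le> n" "n \<le> n * A"
      using assms by (simp_all only: partitions_of_def mem_Collect_eq)
    then show False using assms(2) by linarith
  qed
  define k where "k = (LEAST k. ?f k \<notin># \<pi>)"
  have k: "?f k \<notin># \<pi>" and "k \<le> n"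
    unfolding k_def using large by (rule LeastI, rule Least_le)
  have less: "?f i \<in># \<pi>" if "i < k" for i
    using not_less_Least[of i "\<lambda>k. ?f k \<notin># \<pi>"] that by (simp add: k_def)
  have "mex A a \<pi> = ?f k"
    unfolding mex_def
  proof (rule Least_equality)
    fix m assume "(\<exists>i. m = ?f i) \<and> m \<notin># \<pi>"
    then obtain i where "m = ?f i" "k \<le> i"
      using less not_le by blast
    then show "?f k \<le> m" by simp
  qed (use k in blast)
  \<comment> \<open>The congruence says that 2 A divides k A.\<close>
  moreover have "[?f k = a] (mod (2 * A)) \<longleftrightarrow> even k"
    using assms(1) by (simp add: cong_add_lcancel_0_nat cong_0_iff)
  ultimately have "of_bool [mex A a \<pi> = a] (mod (2 * A)) = (of_bool (even k) :: 'a)"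
    by simp
  \<comment> \<open>The index k itself is included: all terms of the progression before the k-th are
    parts. For i > k the inclusion fails because a + k A is missing.\<close>
  also have "\<dots> = (\<Sum>i<Suc k. (-1) ^ i)"
    by (induction k) auto
  also have "\<dots> = (\<Sum>i<N. (-1) ^ i * of_bool (?f ` {..<i} \<subseteq> set_mset \<pi>))"
  proof (rule sum.mono_neutral_cong_left)
    show "{..<Suc k} \<subseteq> {..<N}" using \<open>k \<le> n\<close> assms by auto
    show "\<forall>i\<in>{..<N} - {..<Suc k}. (-1) ^ i * of_bool (?f ` {..<i} \<subseteq> set_mset \<pi>) = (0 :: 'a)"
      using k by (auto simp: image_subset_iff)
    show "(-1) ^ i = (-1) ^ i * (of_bool (?f ` {..<i} \<subseteq> set_mset \<pi>) :: 'a)"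
      if "i \<in> {..<Suc k}" for i
      using that less by auto
  qed auto
  finally show ?thesis .
qed

text \<open>Cardinalities written as sums of indicators turn the pointwise identity for the mex into
  a double sum, whose order is then exchanged.\<close>

lemma p_mex_eq_alternating_sum:
  assumes "A > 0" "a > 0" "n < N"
  shows "(of_nat (p_mex A a n) :: 'a :: comm_ring_1) = (\<Sum>k<N. (-1) ^ k *
    of_nat (card {\<pi> \<in> partitions_of n. (\<lambda>i. a + i * A) ` {..<k} \<subseteq> set_mset \<pi>}))"
proof -
  have card: "of_nat (card {\<pi> \<in> partitions_of n. Q \<pi>}) =
      (\<Sum>\<pi>\<in>partitions_of n. of_bool (Q \<pi>) :: 'a)" for Q
    by (simp add: finite_partitions_of Int_def of_bool_def flip: sum.inter_filter)
  have "of_nat (p_mex A a n) = (\<Sum>\<pi>\<in>partitions_of n. \<Sum>k<N.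
      (-1) ^ k * of_bool ((\<lambda>i. a + i * A) ` {..<k} \<subseteq> set_mset \<pi>) :: 'a)"
    unfolding p_mex_def card
    by (rule sum.cong[OF refl]) (rule mex_cong_iff[OF assms(1,2) _ assms(3)])
  also have "\<dots> = (\<Sum>k<N. (-1) ^ k *
      of_nat (card {\<pi> \<in> partitions_of n. (\<lambda>i. a + i * A) ` {..<k} \<subseteq> set_mset \<pi>}))"
    unfolding card sum_distrib_left by (rule sum.swap)
  finally show ?thesis .
qed

section \<open>Convergence of the series and comparison of coefficients\<close>

lemma summable_mult_fps_X_power:
  fixes c :: "nat \<Rightarrow> 'a :: comm_ring_1 fps"
  assumes "\<And>n. n \<le> e n"
  shows "summable (\<lambda>n. c n * fps_X ^ e n)"
proof -
  define s where "s = (\<lambda>N. \<Sum>n<N. c n * fps_X ^ e n)"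
  have stable: "fps_nth (s N) m = fps_nth (s (Suc m)) m" if "m < N" for N m
    unfolding s_def fps_sum_nth
  proof (rule sum.mono_neutral_right)
    \<comment> \<open>Terms beyond index m start above degree m, so coefficient m of the partial
      sums no longer changes.\<close>
    have "m < e i" if "i \<ge> Suc m" for i
      using assms[of i] that by linarith
    then show "\<forall>i\<in>{..<N} - {..<Suc m}. fps_nth (c i * fps_X ^ e i) m = 0"
      by (simp add: fps_X_power_mult_right_nth)
  qed (use that in auto)
  have "s \<longlonglongrightarrow> Abs_fps (\<lambda>m. fps_nth (s (Suc m)) m)"
  proof (rule tendsto_fpsI)
    fix m
    show "eventually (\<lambda>N. fps_nth (s N) m =
        fps_nth (Abs_fps (\<lambda>m. fps_nth (s (Suc m)) m)) m) sequentially"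
      using eventually_gt_at_top[of m] by eventually_elim (unfold fps_nth_Abs_fps, rule stable)
  qed
  then show ?thesis
    by (auto simp: summable_def sums_def s_def)
qed

theorem theorem4p1:
  fixes A a :: nat
  assumes "A > 0" and "a > 0"
  shows "Abs_fps (\<lambda>n. of_nat (p_mex A a n)) =
    1 / qq_inf * (\<Sum>n. (-1) ^ n * fps_X ^ (A * n * (n - 1) div 2 + a * n))"
proof -
  let ?t = "\<lambda>n. (-1) ^ n * fps_X ^ (A * n * (n - 1) div 2 + a * n) :: rat fps"
  let ?P = "partitions_avoiding_gf {}"
  let ?F = "\<lambda>k. (\<lambda>i. a + i * A) ` {..<k}"
  have "n \<le> A * n * (n - 1) div 2 + a * n" for n
    using assms(2) by (simp add: trans_le_add2)
  then have "?t sums suminf ?t"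
    by (intro summable_sums summable_mult_fps_X_power)
  then have "(\<lambda>N. sum ?t {..<N} * ?P) \<longlonglongrightarrow> suminf ?t * ?P"
    unfolding sums_def by (rule tendsto_mult_right_fps)
  \<comment> \<open>The same sequence is given a second limit, coefficient by coefficient: for N > m
    the finite alternating sum already equals \<open>p_mex A a m\<close>.\<close>
  moreover have "(\<lambda>N. sum ?t {..<N} * ?P) \<longlonglongrightarrow> Abs_fps (\<lambda>n. of_nat (p_mex A a n))"
  proof (rule tendsto_fpsI)
    fix m
    \<comment> \<open>As \<open>A > 0\<close>, the progression has no repeated terms, so summing
      over the set equals summing over the indices.\<close>
    have sum_F: "\<Sum>(?F k) = A * k * (k - 1) div 2 + a * k" for k
      unfolding sum_arith_progression[symmetric]
      using assms by (subst sum.reindex) (auto simp: inj_on_def)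
    have "0 \<notin> ?F k" for k
      using assms by auto
    then have "?t k * ?P = (-1) ^ k *
        Abs_fps (\<lambda>n. of_nat (card {\<pi> \<in> partitions_of n. ?F k \<subseteq> set_mset \<pi>}))" for k
      using fps_X_power_mult_partitions_avoiding_gf[of "?F k" "{}"]
      by (simp add: sum_F mult.assoc del: One_nat_def)
    moreover have "fps_nth ((-1) ^ k * f) m = (-1) ^ k * fps_nth f m" for k and f :: "rat fps"
      by (cases "even k") simp_all
    ultimately have nth: "fps_nth (?t k * ?P) m =
        (-1) ^ k * of_nat (card {\<pi> \<in> partitions_of m. ?F k \<subseteq> set_mset \<pi>})" for k
      by (simp only: fps_nth_Abs_fps)
    show "eventually (\<lambda>N. fps_nth (sum ?t {..<N} * ?P) m =
        fps_nth (Abs_fps (\<lambda>n. of_nat (p_mex A a n))) m) sequentially"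
      using eventually_gt_at_top[of m]
      by eventually_elim
        (simp only: sum_distrib_right fps_sum_nth nth fps_nth_Abs_fps
          p_mex_eq_alternating_sum[OF assms])
  qed
  ultimately have "Abs_fps (\<lambda>n. of_nat (p_mex A a n)) = suminf ?t * ?P"
    using LIMSEQ_unique by blast
  then show ?thesis
    by (simp add: partitions_gf_eq mult.commute)
qed

end
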